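(* For any nominal transition system $\mathbf T$ and states $P,Q$: if $P\stackrel{\cdot}{\sim}_{\mathbf T}Q$ then $P\stackrel{\cdot}{\sim}_{\mathcal S(\mathbf T)}Q$.
   Context: Nominal sets over a countably infinite (possibly sorted) set of names $\mathcal N$: permutations fix all but finitely many names; every element has finite support $\operatorname{supp}$; $a\# X$ means $a\notin\operatorname{supp}(X)$; $[\mathcal P_{\mathrm{fin}}(\mathcal N)]S$ is $\mathcal P_{\mathrm{fin}}(\mathcal N)\times S$ modulo $(N,X)=_\alpha(N',X')$ iff some $\pi$ with $\pi\cdot(N,X)=(N',X')$ fixes every name of $\operatorname{supp}(X)\setminus N$; classes $\langle N\rangle X$. A nominal transition system: nominal sets STATES, PRED, ACT; equivariant $\vdash\subseteq\mathrm{STATES}\times\mathrm{PRED}$; equivariant $\operatorname{bn}$, $\operatorname{bn}(\alpha)$ a finite subset of $\operatorname{supp}(\alpha)$; equivariant $\rightarrow\ \subseteq\mathrm{STATES}\times[\mathcal P_{\mathrm{fin}}(\mathcal N)](\mathrm{ACT}\times\mathrm{STATES})$ with $(P,\langle N\rangle(\alpha,Q))\in\rightarrow$ only if $N=\operatorname{bn}(\alpha)$; $P\xrightarrow{\alpha}P'$ means $(P,\langle\operatorname{bn}(\alpha)\rangle(\alpha,P'))\in\rightarrow$. A bisimulation is a symmetric relation $R$ on states with: $R(P,Q)$ implies (1) $P\vdash\varphi\Rightarrow Q\vdash\varphi$ for all $\varphi$; (2) whenever $\operatorname{bn}(\alpha)\# Q$ and $P\xrightarrow{\alpha}P'$, some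 $Q'$ has $Q\xrightarrow{\alpha}Q'$ and $R(P',Q')$. $\stackrel{\cdot}{\sim}_{\mathbf T}$ is bisimilarity (union of all bisimulations) in $\mathbf T$. $\mathcal S(\mathbf T)$ is the nominal transition system with: $\mathrm{STATES}_{\mathcal S(\mathbf T)}=\mathrm{STATES}_{\mathbf T}$; $\mathrm{ACT}_{\mathcal S(\mathbf T)}=\mathrm{ACT}_{\mathbf T}\uplus\mathrm{PRED}_{\mathbf T}$; $\operatorname{bn}$ as in $\mathbf T$ on $\mathrm{ACT}_{\mathbf T}$ and $\operatorname{bn}(\varphi)=\emptyset$ for $\varphi\in\mathrm{PRED}_{\mathbf T}$; no state predicates hold ($\vdash_{\mathcal S(\mathbf T)}$ is empty); transitions $P\xrightarrow{\alpha}P'$ in $\mathcal S(\mathbf T)$ iff $P\xrightarrow{\alpha}P'$ in $\mathbf T$ (for $\alpha\in\mathrm{ACT}_{\mathbf T}$), and $P\xrightarrow{\varphi}P$ iff $P\vdash_{\mathbf T}\varphi$ (for $\varphi\in\mathrm{PRED}_{\mathbf T}$), with no other $\varphi$-transitions. *)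

theory Defs
  imports "HOL-Combinatorics.Perm" "HOL-Library.Countable_Set"
begin

unbundle permutation_syntax

section \<open>Nominal sets\<close>

text \<open>Names are the elements of a type, sorted by a function \<open>srt\<close>; the unsorted case is that of a
  constant \<open>srt\<close>. As usual there are infinitely many names of each sort: without this a least
  finite support need not exist.\<close>

definition sorted_names :: "('n \<Rightarrow> 's) \<Rightarrow> bool" where
  "sorted_names srt \<longleftrightarrow> countable (UNIV :: 'n set) \<and> (\<forall>a. infinite {b. srt b = srt a})"

definition name_perms :: "('n \<Rightarrow> 's) \<Rightarrow> 'n perm set" where
  "name_perms srt = {\<pi>. \<forall>a. srt (\<pi> \<langle>$\<rangle> a) = srt a}"

definition supports :: "('n \<Rightarrow> 's) \<Rightarrow> ('n perm \<Rightarrow> 'a \<Rightarrow> 'a) \<Rightarrow> 'n set \<Rightarrow> 'a \<Rightarrow> bool" where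
  "supports srt act A x \<longleftrightarrow>
     (\<forall>\<pi>\<in>name_perms srt. (\<forall>a\<in>A. \<pi> \<langle>$\<rangle> a = a) \<longrightarrow> act \<pi> x = x)"

definition supp :: "('n \<Rightarrow> 's) \<Rightarrow> ('n perm \<Rightarrow> 'a \<Rightarrow> 'a) \<Rightarrow> 'a \<Rightarrow> 'n set" where
  "supp srt act x = \<Inter>{A. finite A \<and> supports srt act A x}"

definition nominal_set :: "('n \<Rightarrow> 's) \<Rightarrow> 'a set \<Rightarrow> ('n perm \<Rightarrow> 'a \<Rightarrow> 'a) \<Rightarrow> bool" where
  "nominal_set srt X act \<longleftrightarrow>
     (\<forall>x\<in>X. act 1 x = x) \<and>
     (\<forall>\<pi>\<in>name_perms srt. \<forall>x\<in>X. act \<pi> x \<in> X) \<and>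
     (\<forall>\<pi>\<in>name_perms srt. \<forall>\<sigma>\<in>name_perms srt. \<forall>x\<in>X. act (\<pi> * \<sigma>) x = act \<pi> (act \<sigma> x)) \<and>
     (\<forall>x\<in>X. \<exists>A. finite A \<and> supports srt act A x)"

definition pair_act ::
  "('n perm \<Rightarrow> 'a \<Rightarrow> 'a) \<Rightarrow> ('n perm \<Rightarrow> 'b \<Rightarrow> 'b) \<Rightarrow> 'n perm \<Rightarrow> 'a \<times> 'b \<Rightarrow> 'a \<times> 'b" where
  "pair_act act1 act2 \<pi> = map_prod (act1 \<pi>) (act2 \<pi>)"

definition names_act :: "'n perm \<Rightarrow> 'n set \<Rightarrow> 'n set" where
  "names_act \<pi> N = apply \<pi> ` N"

definition alpha_rel ::
  "('n \<Rightarrow> 's) \<Rightarrow> 'a set \<Rightarrow> ('n perm \<Rightarrow> 'a \<Rightarrow> 'a) \<Rightarrow> ('n set \<times> 'a) rel" where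
  "alpha_rel srt X act =
     {((N, x), (N', x')). (N, x) \<in> Fpow UNIV \<times> X \<and> (N', x') \<in> Fpow UNIV \<times> X \<and>
        (\<exists>\<pi>\<in>name_perms srt. pair_act names_act act \<pi> (N, x) = (N', x') \<and>
           (\<forall>a\<in>supp srt act x - N. \<pi> \<langle>$\<rangle> a = a))}"

definition abstr ::
  "('n \<Rightarrow> 's) \<Rightarrow> 'a set \<Rightarrow> ('n perm \<Rightarrow> 'a \<Rightarrow> 'a) \<Rightarrow> 'n set \<Rightarrow> 'a \<Rightarrow> ('n set \<times> 'a) set" where
  "abstr srt X act N x = alpha_rel srt X act `` {(N, x)}"

definition abstractions ::
  "('n \<Rightarrow> 's) \<Rightarrow> 'a set \<Rightarrow> ('n perm \<Rightarrow> 'a \<Rightarrow> 'a) \<Rightarrow> ('n set \<times> 'a) set set" where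
  "abstractions srt X act = (Fpow UNIV \<times> X) // alpha_rel srt X act"

text \<open>The elementwise action on a class, which is \<open>\<pi> \<bullet> \<langle>N\<rangle>x = \<langle>\<pi> \<bullet> N\<rangle>(\<pi> \<bullet> x)\<close>.\<close>

definition abstr_act ::
  "('n perm \<Rightarrow> 'a \<Rightarrow> 'a) \<Rightarrow> 'n perm \<Rightarrow> ('n set \<times> 'a) set \<Rightarrow> ('n set \<times> 'a) set" where
  "abstr_act act \<pi> C = pair_act names_act act \<pi> ` C"

definition equivariant_rel ::
  "('n \<Rightarrow> 's) \<Rightarrow> ('n perm \<Rightarrow> 'a \<Rightarrow> 'a) \<Rightarrow> ('n perm \<Rightarrow> 'b \<Rightarrow> 'b) \<Rightarrow> ('a \<times> 'b) set \<Rightarrow> bool" where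
  "equivariant_rel srt act1 act2 R \<longleftrightarrow>
     (\<forall>\<pi>\<in>name_perms srt. \<forall>(x, y)\<in>R. (act1 \<pi> x, act2 \<pi> y) \<in> R)"


section \<open>Nominal transition systems and bisimilarity\<close>

record ('n, 'st, 'pr, 'ac) nts =
  STATES :: "'st set"
  PRED :: "'pr set"
  ACT :: "'ac set"
  state_act :: "'n perm \<Rightarrow> 'st \<Rightarrow> 'st"
  pred_act :: "'n perm \<Rightarrow> 'pr \<Rightarrow> 'pr"
  action_act :: "'n perm \<Rightarrow> 'ac \<Rightarrow> 'ac"
  sat :: "('st \<times> 'pr) set"
  bn :: "'ac \<Rightarrow> 'n set"
  transitions :: "('st \<times> ('n set \<times> ('ac \<times> 'st)) set) set"

abbreviation residuals :: "('n, 'st, 'pr, 'ac) nts \<Rightarrow> ('ac \<times> 'st) set" where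
  "residuals T \<equiv> ACT T \<times> STATES T"

abbreviation residual_act :: "('n, 'st, 'pr, 'ac) nts \<Rightarrow> 'n perm \<Rightarrow> 'ac \<times> 'st \<Rightarrow> 'ac \<times> 'st" where
  "residual_act T \<equiv> pair_act (action_act T) (state_act T)"

definition nominal_transition_system :: "('n \<Rightarrow> 's) \<Rightarrow> ('n, 'st, 'pr, 'ac) nts \<Rightarrow> bool" where
  "nominal_transition_system srt T \<longleftrightarrow>
     nominal_set srt (STATES T) (state_act T) \<and>
     nominal_set srt (PRED T) (pred_act T) \<and>
     nominal_set srt (ACT T) (action_act T) \<and>
     sat T \<subseteq> STATES T \<times> PRED T \<and>
     equivariant_rel srt (state_act T) (pred_act T) (sat T) \<and>
     (\<forall>\<alpha>\<in>ACT T. finite (bn T \<alpha>) \<and> bn T \<alpha> \<subseteq> supp srt (action_act T) \<alpha>) \<and>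
     (\<forall>\<pi>\<in>name_perms srt. \<forall>\<alpha>\<in>ACT T. bn T (action_act T \<pi> \<alpha>) = names_act \<pi> (bn T \<alpha>)) \<and>
     transitions T \<subseteq> STATES T \<times> abstractions srt (residuals T) (residual_act T) \<and>
     equivariant_rel srt (state_act T) (abstr_act (residual_act T)) (transitions T) \<and>
     (\<forall>P N. \<forall>\<alpha>\<in>ACT T. \<forall>Q\<in>STATES T. finite N \<longrightarrow>
        (P, abstr srt (residuals T) (residual_act T) N (\<alpha>, Q)) \<in> transitions T \<longrightarrow> N = bn T \<alpha>)"

definition step :: "('n \<Rightarrow> 's) \<Rightarrow> ('n, 'st, 'pr, 'ac) nts \<Rightarrow> 'st \<Rightarrow> 'ac \<Rightarrow> 'st \<Rightarrow> bool" where
  "step srt T P \<alpha> P' \<longleftrightarrow>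
     (P, abstr srt (residuals T) (residual_act T) (bn T \<alpha>) (\<alpha>, P')) \<in> transitions T"

definition bisimulation :: "('n \<Rightarrow> 's) \<Rightarrow> ('n, 'st, 'pr, 'ac) nts \<Rightarrow> 'st rel \<Rightarrow> bool" where
  "bisimulation srt T R \<longleftrightarrow>
     R \<subseteq> STATES T \<times> STATES T \<and> sym R \<and>
     (\<forall>(P, Q)\<in>R.
        (\<forall>\<phi>\<in>PRED T. (P, \<phi>) \<in> sat T \<longrightarrow> (Q, \<phi>) \<in> sat T) \<and>
        (\<forall>\<alpha>\<in>ACT T. \<forall>P'\<in>STATES T.
           bn T \<alpha> \<inter> supp srt (state_act T) Q = {} \<longrightarrow> step srt T P \<alpha> P' \<longrightarrow>
           (\<exists>Q'\<in>STATES T. step srt T Q \<alpha> Q' \<and> (P', Q') \<in> R)))"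

definition bisimilarity :: "('n \<Rightarrow> 's) \<Rightarrow> ('n, 'st, 'pr, 'ac) nts \<Rightarrow> 'st rel" where
  "bisimilarity srt T = \<Union>{R. bisimulation srt T R}"


section \<open>Turning state predicates into actions\<close>

abbreviation S_ACT :: "('n, 'st, 'pr, 'ac) nts \<Rightarrow> ('ac + 'pr) set" where
  "S_ACT T \<equiv> ACT T <+> PRED T"

abbreviation S_action_act ::
  "('n, 'st, 'pr, 'ac) nts \<Rightarrow> 'n perm \<Rightarrow> 'ac + 'pr \<Rightarrow> 'ac + 'pr" where
  "S_action_act T \<pi> \<equiv> map_sum (action_act T \<pi>) (pred_act T \<pi>)"

abbreviation S_abstr ::
  "('n \<Rightarrow> 's) \<Rightarrow> ('n, 'st, 'pr, 'ac) nts \<Rightarrow> 'n set \<Rightarrow> ('ac + 'pr) \<times> 'st \<Rightarrow>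
     ('n set \<times> (('ac + 'pr) \<times> 'st)) set" where
  "S_abstr srt T \<equiv>
     abstr srt (S_ACT T \<times> STATES T) (pair_act (S_action_act T) (state_act T))"

text \<open>The nominal set of predicates is kept, but none of them holds anywhere.\<close>

definition S_transform ::
  "('n \<Rightarrow> 's) \<Rightarrow> ('n, 'st, 'pr, 'ac) nts \<Rightarrow> ('n, 'st, 'pr, 'ac + 'pr) nts" where
  "S_transform srt T =
     \<lparr>STATES = STATES T,
      PRED = PRED T,
      ACT = S_ACT T,
      state_act = state_act T,
      pred_act = pred_act T,
      action_act = S_action_act T,
      sat = {},
      bn = case_sum (bn T) (\<lambda>\<phi>. {}),
      transitions =
        {(P, S_abstr srt T (bn T \<alpha>) (Inl \<alpha>, P')) | P \<alpha> P'.
           \<alpha> \<in> ACT T \<and> P' \<in> STATES T \<and> step srt T P \<alpha> P'} \<union>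
        {(P, S_abstr srt T {} (Inr \<phi>, P)) | P \<phi>. (P, \<phi>) \<in> sat T}\<rparr>"


section \<open>Well-definedness of the transform\<close>

text \<open>The transitions above are given as abstractions; the following facts show that the transform
  is a nominal transition system with exactly the intended transitions.\<close>

lemma nominal_setD:
  assumes "nominal_set srt X act" "x \<in> X"
  shows "act 1 x = x"
    and "\<pi> \<in> name_perms srt \<Longrightarrow> act \<pi> x \<in> X"
    and "\<pi> \<in> name_perms srt \<Longrightarrow> \<sigma> \<in> name_perms srt \<Longrightarrow> act (\<pi> * \<sigma>) x = act \<pi> (act \<sigma> x)"
    and "\<exists>A. finite A \<and> supports srt act A x"
  using assms unfolding nominal_set_def by blast+

lemma nominal_setI:
  assumes "\<And>x. x \<in> X \<Longrightarrow> act 1 x = x"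
    and "\<And>\<pi> x. \<pi> \<in> name_perms srt \<Longrightarrow> x \<in> X \<Longrightarrow> act \<pi> x \<in> X"
    and "\<And>\<pi> \<sigma> x. \<pi> \<in> name_perms srt \<Longrightarrow> \<sigma> \<in> name_perms srt \<Longrightarrow> x \<in> X \<Longrightarrow>
      act (\<pi> * \<sigma>) x = act \<pi> (act \<sigma> x)"
    and "\<And>x. x \<in> X \<Longrightarrow> \<exists>A. finite A \<and> supports srt act A x"
  shows "nominal_set srt X act"
  unfolding nominal_set_def by (intro conjI ballI) (fact assms)+

lemma swap_in_name_perms:
  assumes "srt a = srt b"
  shows "\<langle>a \<leftrightarrow> b\<rangle> \<in> name_perms srt"
proof -
  have "srt (\<langle>a \<leftrightarrow> b\<rangle> \<langle>$\<rangle> c) = srt c" for c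
    using assms by (cases "c = a"; cases "c = b") auto
  then show ?thesis by (simp add: name_perms_def)
qed

lemma times_in_name_perms:
  "\<pi> \<in> name_perms srt \<Longrightarrow> \<sigma> \<in> name_perms srt \<Longrightarrow> \<pi> * \<sigma> \<in> name_perms srt"
  by (simp add: name_perms_def apply_times)

lemma one_in_name_perms: "1 \<in> name_perms srt"
  by (simp add: name_perms_def)

lemma fixed_if_fixed_by_swaps:
  assumes X: "nominal_set srt X act" "x \<in> X"
    and sw: "\<And>a b. srt a = srt b \<Longrightarrow> a \<notin> C \<Longrightarrow> b \<notin> C \<Longrightarrow> act \<langle>a \<leftrightarrow> b\<rangle> x = x"
    and "\<pi> \<in> name_perms srt" "\<forall>a\<in>C. \<pi> \<langle>$\<rangle> a = a"
  shows "act \<pi> x = x"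
  using assms(4,5)
proof (induction "card (affected \<pi>)" arbitrary: \<pi> rule: less_induct)
  case less
  show ?case
  proof (cases "\<pi> = 1")
    case True
    then show ?thesis using nominal_setD(1)[OF X] by simp
  next
    case False
    then obtain a where a: "\<pi> \<langle>$\<rangle> a \<noteq> a" by (auto simp: perm_eq_iff)
    define b where "b = \<pi> \<langle>$\<rangle> a"
    define \<sigma> where "\<sigma> = \<langle>a \<leftrightarrow> b\<rangle> * \<pi>"
    have ab: "srt a = srt b" using less.prems by (simp add: name_perms_def b_def)
    have b: "\<pi> \<langle>$\<rangle> b \<noteq> b" using a by (simp add: b_def apply_inj)
    have fix_: "\<sigma> \<langle>$\<rangle> c = c" if "\<pi> \<langle>$\<rangle> c = c" for c
    proof -
      have "c \<noteq> a" "c \<noteq> b" using that a b by auto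
      then show ?thesis using that by (simp add: \<sigma>_def apply_times apply_swap_same)
    qed
    have "\<sigma> \<langle>$\<rangle> a = a" by (simp add: \<sigma>_def apply_times flip: b_def)
    then have "affected \<sigma> \<subset> affected \<pi>" using fix_ a by (auto simp: in_affected)
    then have card: "card (affected \<sigma>) < card (affected \<pi>)" by (simp add: psubset_card_mono)
    have sigma: "\<sigma> \<in> name_perms srt"
      unfolding \<sigma>_def using less.prems swap_in_name_perms[of srt a b, OF ab] by (blast intro: times_in_name_perms)
    have "act \<sigma> x = x" using less.hyps[OF card sigma] less.prems fix_ by blast
    moreover have "\<pi> = \<langle>a \<leftrightarrow> b\<rangle> * \<sigma>" by (simp add: \<sigma>_def flip: mult.assoc)
    moreover have "act \<langle>a \<leftrightarrow> b\<rangle> x = x" using sw[OF ab] a b less.prems by metis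
    ultimately show ?thesis
      using nominal_setD(3)[OF X swap_in_name_perms[of srt a b, OF ab] sigma] by simp
  qed
qed

lemma supports_Int:
  assumes n: "sorted_names srt" and X: "nominal_set srt X act" "x \<in> X"
    and A: "finite A" "supports srt act A x" and B: "finite B" "supports srt act B x"
  shows "supports srt act (A \<inter> B) x"
proof -
  have sw: "act \<langle>a \<leftrightarrow> b\<rangle> x = x" if "srt a = srt b" "a \<notin> D" "b \<notin> D" "supports srt act D x" for a b D
  proof -
    have "\<forall>d\<in>D. \<langle>a \<leftrightarrow> b\<rangle> \<langle>$\<rangle> d = d" using that by (metis apply_swap_same)
    then show ?thesis using that swap_in_name_perms[of srt a b] unfolding supports_def by blast
  qed
  have "act \<langle>a \<leftrightarrow> b\<rangle> x = x" if ab: "srt a = srt b" "a \<notin> A \<inter> B" "b \<notin> A \<inter> B" for a b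
  proof (cases "a = b \<or> a \<notin> A \<and> b \<notin> A \<or> a \<notin> B \<and> b \<notin> B")
    case True
    moreover have "act \<langle>a \<leftrightarrow> b\<rangle> x = x" if "a = b" using that nominal_setD(1)[OF X] by simp
    ultimately show ?thesis using sw[OF ab(1)] A(2) B(2) by metis
  next
    case False
    have "infinite {c. srt c = srt a}" using n by (simp add: sorted_names_def)
    then have "infinite ({c. srt c = srt a} - (A \<union> B \<union> {a, b}))"
      using A B by (intro Diff_infinite_finite) auto
    then obtain c where "c \<in> {c. srt c = srt a} - (A \<union> B \<union> {a, b})"
      by (metis all_not_in_conv infinite_imp_nonempty)
    then have c: "srt c = srt a" "c \<notin> A" "c \<notin> B" "c \<noteq> a" "c \<noteq> b" by auto
    have 1: "act \<langle>a \<leftrightarrow> c\<rangle> x = x"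
      using sw[of a c A] sw[of a c B] ab(2) c A(2) B(2) by auto
    have 2: "act \<langle>b \<leftrightarrow> c\<rangle> x = x"
      using sw[of b c A] sw[of b c B] ab(1,3) c A(2) B(2) by auto
    have eq: "\<langle>a \<leftrightarrow> b\<rangle> = \<langle>a \<leftrightarrow> c\<rangle> * (\<langle>b \<leftrightarrow> c\<rangle> * \<langle>a \<leftrightarrow> c\<rangle>)"
    proof (rule perm_eqI)
      fix d
      show "\<langle>a \<leftrightarrow> b\<rangle> \<langle>$\<rangle> d = (\<langle>a \<leftrightarrow> c\<rangle> * (\<langle>b \<leftrightarrow> c\<rangle> * \<langle>a \<leftrightarrow> c\<rangle>)) \<langle>$\<rangle> d"
        using c False by (cases "d = a"; cases "d = b"; cases "d = c") (auto simp: apply_times)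
    qed
    have mem: "\<langle>a \<leftrightarrow> c\<rangle> \<in> name_perms srt" "\<langle>b \<leftrightarrow> c\<rangle> \<in> name_perms srt"
      using c ab by (simp_all add: swap_in_name_perms)
    have "act \<langle>a \<leftrightarrow> b\<rangle> x = act \<langle>a \<leftrightarrow> c\<rangle> (act \<langle>b \<leftrightarrow> c\<rangle> (act \<langle>a \<leftrightarrow> c\<rangle> x))"
      using nominal_setD(3)[OF X mem(1) times_in_name_perms[OF mem(2,1)]]
        nominal_setD(3)[OF X mem(2,1)] by (simp add: eq)
    then show ?thesis using 1 2 by simp
  qed
  from fixed_if_fixed_by_swaps[OF X, of "A \<inter> B", OF this] show ?thesis
    unfolding supports_def by simp
qed

lemma supp_supports:
  assumes n: "sorted_names srt" and X: "nominal_set srt X act" "x \<in> X"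
  shows "finite (supp srt act x)" "supports srt act (supp srt act x) x"
proof -
  have "\<exists>A. finite A \<and> supports srt act A x" by (fact nominal_setD(4)[OF X])
  then obtain A0 where A0: "finite A0 \<and> supports srt act A0 x" ..
  obtain A where "finite A \<and> supports srt act A x"
    and "\<forall>B. finite B \<and> supports srt act B x \<longrightarrow> card A \<le> card B"
    using ex_has_least_nat[of "\<lambda>A. finite A \<and> supports srt act A x", OF A0, of card] by (elim exE conjE) blast
  then have A: "finite A" "supports srt act A x"
    and least: "\<And>B. finite B \<Longrightarrow> supports srt act B x \<Longrightarrow> card A \<le> card B"
    by simp_all
  have "A \<subseteq> B" if B: "finite B" "supports srt act B x" for B
  proof -
    have "card A \<le> card (A \<inter> B)"
      using least[OF _ supports_Int[OF n X A B]] A by simp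
    then have "A \<inter> B = A" using card_seteq[OF A(1), of "A \<inter> B"] by simp
    then show ?thesis by blast
  qed
  then have "supp srt act x = A" using A unfolding supp_def by blast
  then show "finite (supp srt act x)" "supports srt act (supp srt act x) x" using A by simp_all
qed

lemma nominal_set_pair:
  assumes X: "nominal_set srt X act1" and Y: "nominal_set srt Y act2"
  shows "nominal_set srt (X \<times> Y) (pair_act act1 act2)"
proof (rule nominal_setI)
  fix z assume "z \<in> X \<times> Y"
  then obtain x y where z: "z = (x, y)" "x \<in> X" "y \<in> Y" by blast
  obtain A where "finite A" "supports srt act1 A x" using nominal_setD(4)[OF X z(2)] by blast
  moreover obtain B where "finite B" "supports srt act2 B y" using nominal_setD(4)[OF Y z(3)] by blast
  ultimately have "finite (A \<union> B) \<and> supports srt (pair_act act1 act2) (A \<union> B) z"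
    by (simp add: supports_def pair_act_def z(1))
  then show "\<exists>A. finite A \<and> supports srt (pair_act act1 act2) A z" by blast
qed (auto simp: pair_act_def nominal_setD(1-3)[OF X] nominal_setD(1-3)[OF Y])

lemma nominal_set_sum:
  assumes X: "nominal_set srt X act1" and Y: "nominal_set srt Y act2"
  shows "nominal_set srt (X <+> Y) (\<lambda>\<pi>. map_sum (act1 \<pi>) (act2 \<pi>))"
proof (rule nominal_setI)
  fix z assume "z \<in> X <+> Y"
  then show "\<exists>A. finite A \<and> supports srt (\<lambda>\<pi>. map_sum (act1 \<pi>) (act2 \<pi>)) A z"
  proof (rule PlusE)
    fix x assume "x \<in> X" "z = Inl x"
    then show ?thesis using nominal_setD(4)[OF X, of x] by (simp add: supports_def)
  next
    fix y assume "y \<in> Y" "z = Inr y"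
    then show ?thesis using nominal_setD(4)[OF Y, of y] by (simp add: supports_def)
  qed
qed (auto simp: nominal_setD(1-3)[OF X] nominal_setD(1-3)[OF Y])

lemma supp_Inl: "supp srt (\<lambda>\<pi>. map_sum (act1 \<pi>) (act2 \<pi>)) (Inl x) = supp srt act1 x"
  by (simp add: supp_def supports_def)

lemma supp_pair_Inl:
  "supp srt (pair_act (\<lambda>\<pi>. map_sum (act1 \<pi>) (act2 \<pi>)) act3) (Inl x, y) =
     supp srt (pair_act act1 act3) (x, y)"
  by (simp add: supp_def supports_def pair_act_def)

lemma abstr_self:
  assumes "nominal_set srt X act" "x \<in> X" "finite N"
  shows "(N, x) \<in> abstr srt X act N x"
proof -
  have "pair_act names_act act 1 (N, x) = (N, x)"
    using nominal_setD(1)[OF assms(1,2)] by (simp add: pair_act_def names_act_def)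
  then have "\<exists>\<pi>\<in>name_perms srt. pair_act names_act act \<pi> (N, x) = (N, x) \<and>
      (\<forall>a\<in>supp srt act x - N. \<pi> \<langle>$\<rangle> a = a)"
    using one_in_name_perms[of srt] by (intro bexI[of _ 1]) simp_all
  then show ?thesis using assms(2,3) by (simp add: abstr_def alpha_rel_def Fpow_def)
qed

lemma abstr_empty:
  assumes n: "sorted_names srt" and X: "nominal_set srt X act" "x \<in> X"
  shows "abstr srt X act {} x = {({}, x)}"
proof
  show "abstr srt X act {} x \<subseteq> {({}, x)}"
  proof clarify
    fix N' x' assume "(N', x') \<in> abstr srt X act {} x"
    then obtain \<pi> where "\<pi> \<in> name_perms srt" "\<forall>a\<in>supp srt act x. \<pi> \<langle>$\<rangle> a = a"
      "N' = {}" "x' = act \<pi> x"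
      by (auto simp: abstr_def alpha_rel_def pair_act_def names_act_def)
    then show "N' = {} \<and> x' = x"
      using supp_supports(2)[OF assms] unfolding supports_def by blast
  qed
  show "{({}, x)} \<subseteq> abstr srt X act {} x" using abstr_self[OF X] by simp
qed

definition Inl_residual :: "'n set \<times> ('ac \<times> 'st) \<Rightarrow> 'n set \<times> (('ac + 'pr) \<times> 'st)" where
  "Inl_residual = map_prod id (map_prod Inl id)"

lemma inj_Inl_residual: "inj Inl_residual"
  unfolding Inl_residual_def by (intro prod.inj_map) auto

lemma S_abstr_Inl:
  "S_abstr srt T N (Inl \<alpha>, P) =
     Inl_residual ` abstr srt (residuals T) (residual_act T) N (\<alpha>, P)"
  unfolding abstr_def alpha_rel_def
  by (auto simp: supp_pair_Inl Inl_residual_def pair_act_def image_iff Fpow_def)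

lemma S_abstr_Inl_eq_iff:
  "S_abstr srt T N (Inl \<alpha>, P) = S_abstr srt T N' (Inl \<beta>, Q) \<longleftrightarrow>
     abstr srt (residuals T) (residual_act T) N (\<alpha>, P) =
     abstr srt (residuals T) (residual_act T) N' (\<beta>, Q)"
  by (simp add: S_abstr_Inl inj_image_eq_iff[OF inj_Inl_residual])

context
  fixes srt :: "'n \<Rightarrow> 's" and T :: "('n, 'st, 'pr, 'ac) nts"
  assumes n: "sorted_names srt" and T: "nominal_transition_system srt T"
begin

lemma S_residuals_nominal:
  "nominal_set srt (S_ACT T \<times> STATES T) (pair_act (S_action_act T) (state_act T))"
  using T by (intro nominal_set_pair nominal_set_sum) (auto simp: nominal_transition_system_def)

lemma S_abstr_Inr:
  "\<phi> \<in> PRED T \<Longrightarrow> P \<in> STATES T \<Longrightarrow> S_abstr srt T {} (Inr \<phi>, P) = {({}, (Inr \<phi>, P))}"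
  by (intro abstr_empty[OF n S_residuals_nominal]) auto

lemma sat_dest: "(P, \<phi>) \<in> sat T \<Longrightarrow> P \<in> STATES T \<and> \<phi> \<in> PRED T"
  using T by (auto simp: nominal_transition_system_def)

lemma S_trans_Inl_iff:
  assumes "\<alpha> \<in> ACT T" "P' \<in> STATES T" "finite N"
  shows "(P, S_abstr srt T N (Inl \<alpha>, P')) \<in> transitions (S_transform srt T) \<longleftrightarrow>
     (P, abstr srt (residuals T) (residual_act T) N (\<alpha>, P')) \<in> transitions T"
    (is "?L \<longleftrightarrow> ?R")
proof
  assume ?L
  then consider \<beta> Q' where "S_abstr srt T N (Inl \<alpha>, P') = S_abstr srt T (bn T \<beta>) (Inl \<beta>, Q')"
      "step srt T P \<beta> Q'"
    | \<phi> where "S_abstr srt T N (Inl \<alpha>, P') = S_abstr srt T {} (Inr \<phi>, P)" "(P, \<phi>) \<in> sat T"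
    by (auto simp: S_transform_def)
  then show ?R
  proof cases
    case 1
    then show ?thesis by (simp only: S_abstr_Inl_eq_iff step_def)
  next
    case 2
    have "(N, (Inl \<alpha>, P')) \<in> S_abstr srt T N (Inl \<alpha>, P')"
      using assms by (intro abstr_self[OF S_residuals_nominal]) auto
    then show ?thesis using 2 S_abstr_Inr sat_dest by auto
  qed
next
  assume R: ?R
  then have "N = bn T \<alpha>" using T assms unfolding nominal_transition_system_def by blast
  then show ?L using R assms by (auto simp: S_transform_def step_def)
qed

lemma S_trans_Inr_iff:
  assumes "\<phi> \<in> PRED T" "P' \<in> STATES T" "finite N"
  shows "(P, S_abstr srt T N (Inr \<phi>, P')) \<in> transitions (S_transform srt T) \<longleftrightarrow>
     N = {} \<and> P' = P \<and> (P, \<phi>) \<in> sat T"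
    (is "?L \<longleftrightarrow> ?R")
proof
  have self: "(N, (Inr \<phi>, P')) \<in> S_abstr srt T N (Inr \<phi>, P')"
    using assms by (intro abstr_self[OF S_residuals_nominal]) auto
  assume ?L
  then consider \<beta> Q' where "S_abstr srt T N (Inr \<phi>, P') = S_abstr srt T (bn T \<beta>) (Inl \<beta>, Q')"
    | \<psi> where "S_abstr srt T N (Inr \<phi>, P') = S_abstr srt T {} (Inr \<psi>, P)" "(P, \<psi>) \<in> sat T"
    by (auto simp: S_transform_def)
  then show ?R
  proof cases
    case 1
    then show ?thesis using self by (auto simp: S_abstr_Inl Inl_residual_def)
  next
    case 2
    then show ?thesis using self S_abstr_Inr sat_dest by auto
  qed
next
  assume ?R
  then show ?L by (auto simp: S_transform_def)
qed

lemma S_step_Inl: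
  assumes "\<alpha> \<in> ACT T" "P' \<in> STATES T"
  shows "step srt (S_transform srt T) P (Inl \<alpha>) P' \<longleftrightarrow> step srt T P \<alpha> P'"
proof -
  have "finite (bn T \<alpha>)" using T assms by (simp add: nominal_transition_system_def)
  from S_trans_Inl_iff[OF assms this] show ?thesis by (simp add: step_def S_transform_def)
qed

lemma S_step_Inr:
  assumes "\<phi> \<in> PRED T" "P' \<in> STATES T"
  shows "step srt (S_transform srt T) P (Inr \<phi>) P' \<longleftrightarrow> P' = P \<and> (P, \<phi>) \<in> sat T"
  using S_trans_Inr_iff[OF assms, of "{}"] by (simp add: step_def S_transform_def)

lemma S_equivariant:
  "equivariant_rel srt (state_act T) (abstr_act (pair_act (S_action_act T) (state_act T)))
     (transitions (S_transform srt T))"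
  unfolding equivariant_rel_def
proof (intro ballI, clarify)
  fix \<pi> P C assume pi: "\<pi> \<in> name_perms srt" and "(P, C) \<in> transitions (S_transform srt T)"
  then consider \<alpha> P' where "C = S_abstr srt T (bn T \<alpha>) (Inl \<alpha>, P')" "step srt T P \<alpha> P'"
    | \<phi> where "C = S_abstr srt T {} (Inr \<phi>, P)" "(P, \<phi>) \<in> sat T"
    by (auto simp: S_transform_def)
  then show "(state_act T \<pi> P, abstr_act (pair_act (S_action_act T) (state_act T)) \<pi> C)
      \<in> transitions (S_transform srt T)"
  proof cases
    case 1
    define D where "D = abstr_act (residual_act T) \<pi>
      (abstr srt (residuals T) (residual_act T) (bn T \<alpha>) (\<alpha>, P'))"
    have "equivariant_rel srt (state_act T) (abstr_act (residual_act T)) (transitions T)"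
      using T by (simp add: nominal_transition_system_def)
    then have D: "(state_act T \<pi> P, D) \<in> transitions T"
      using pi 1(2) unfolding equivariant_rel_def step_def D_def by blast
    then have "D \<in> abstractions srt (residuals T) (residual_act T)"
      using T by (auto simp: nominal_transition_system_def)
    then obtain N \<beta> Q where Q: "finite N" "\<beta> \<in> ACT T" "Q \<in> STATES T"
      "D = abstr srt (residuals T) (residual_act T) N (\<beta>, Q)"
      by (auto simp: abstractions_def abstr_def Fpow_def elim!: quotientE)
    have "abstr_act (pair_act (S_action_act T) (state_act T)) \<pi> C = Inl_residual ` D"
      unfolding 1(1) D_def S_abstr_Inl abstr_act_def image_image
      by (intro image_cong) (auto simp: Inl_residual_def pair_act_def)
    also have "\<dots> = S_abstr srt T N (Inl \<beta>, Q)" by (simp add: Q(4) S_abstr_Inl)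
    finally have C: "abstr_act (pair_act (S_action_act T) (state_act T)) \<pi> C =
        S_abstr srt T N (Inl \<beta>, Q)" .
    show ?thesis unfolding C S_trans_Inl_iff[OF Q(2,3,1)] using D unfolding Q(4) .
  next
    case 2
    have "equivariant_rel srt (state_act T) (pred_act T) (sat T)"
      using T by (simp add: nominal_transition_system_def)
    then have *: "(state_act T \<pi> P, pred_act T \<pi> \<phi>) \<in> sat T"
      using pi 2(2) unfolding equivariant_rel_def by blast
    have "abstr_act (pair_act (S_action_act T) (state_act T)) \<pi> C =
        {({}, (Inr (pred_act T \<pi> \<phi>), state_act T \<pi> P))}"
      using 2 sat_dest by (simp add: S_abstr_Inr abstr_act_def pair_act_def names_act_def)
    also have "\<dots> = S_abstr srt T {} (Inr (pred_act T \<pi> \<phi>), state_act T \<pi> P)"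
      using sat_dest[OF *] by (simp add: S_abstr_Inr)
    finally have C: "abstr_act (pair_act (S_action_act T) (state_act T)) \<pi> C =
        S_abstr srt T {} (Inr (pred_act T \<pi> \<phi>), state_act T \<pi> P)" .
    have "pred_act T \<pi> \<phi> \<in> PRED T" "state_act T \<pi> P \<in> STATES T" using sat_dest[OF *] by auto
    then show ?thesis unfolding C using * by (subst S_trans_Inr_iff) auto
  qed
qed

theorem S_transform_nts: "nominal_transition_system srt (S_transform srt T)"
proof -
  have nom: "nominal_set srt (S_ACT T) (S_action_act T)"
    using T by (intro nominal_set_sum) (simp_all add: nominal_transition_system_def)
  have sub: "transitions (S_transform srt T) \<subseteq> STATES T \<times>
      abstractions srt (S_ACT T \<times> STATES T) (pair_act (S_action_act T) (state_act T))"
  proof clarify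
    fix P C assume "(P, C) \<in> transitions (S_transform srt T)"
    then consider \<alpha> P' where "C = S_abstr srt T (bn T \<alpha>) (Inl \<alpha>, P')" "step srt T P \<alpha> P'"
        "\<alpha> \<in> ACT T" "P' \<in> STATES T"
      | \<phi> where "C = S_abstr srt T {} (Inr \<phi>, P)" "(P, \<phi>) \<in> sat T"
      by (auto simp: S_transform_def)
    then show "P \<in> STATES T \<and> C \<in>
        abstractions srt (S_ACT T \<times> STATES T) (pair_act (S_action_act T) (state_act T))"
    proof cases
      case 1
      then have "P \<in> STATES T" "finite (bn T \<alpha>)"
        using T by (auto simp: nominal_transition_system_def step_def)
      then show ?thesis
        using 1 by (auto simp: abstractions_def abstr_def Fpow_def intro!: quotientI)
    next
      case 2
      then show ?thesis using sat_dest[OF 2(2)]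
        by (auto simp: abstractions_def abstr_def Fpow_def intro!: quotientI)
    qed
  qed
  have bn: "N = case_sum (bn T) (\<lambda>\<phi>. {}) \<alpha>"
    if "\<alpha> \<in> S_ACT T" "Q \<in> STATES T" "finite N"
      "(P, S_abstr srt T N (\<alpha>, Q)) \<in> transitions (S_transform srt T)" for P N \<alpha> Q
    using that(1)
  proof (rule PlusE)
    fix a assume a: "a \<in> ACT T" "\<alpha> = Inl a"
    then have "(P, abstr srt (residuals T) (residual_act T) N (a, Q)) \<in> transitions T"
      using S_trans_Inl_iff[OF a(1) that(2,3)] that(4) by simp
    then have "N = bn T a" using T a(1) that(2,3) unfolding nominal_transition_system_def by blast
    then show ?thesis by (simp add: a(2))
  next
    fix \<phi> assume \<phi>: "\<phi> \<in> PRED T" "\<alpha> = Inr \<phi>"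
    then show ?thesis using S_trans_Inr_iff[OF \<phi>(1) that(2,3)] that(4) by simp
  qed
  have bnT: "\<forall>\<alpha>\<in>ACT T. finite (bn T \<alpha>) \<and> bn T \<alpha> \<subseteq> supp srt (action_act T) \<alpha>"
    and bnT_eqv: "\<forall>\<pi>\<in>name_perms srt. \<forall>\<alpha>\<in>ACT T. bn T (action_act T \<pi> \<alpha>) = names_act \<pi> (bn T \<alpha>)"
    using T by (simp_all add: nominal_transition_system_def)
  have fin: "finite (case_sum (bn T) (\<lambda>\<phi>. {}) \<alpha>) \<and>
      case_sum (bn T) (\<lambda>\<phi>. {}) \<alpha> \<subseteq> supp srt (S_action_act T) \<alpha>" if "\<alpha> \<in> S_ACT T" for \<alpha>
    using that bnT by (fastforce simp: supp_Inl)
  have eqv: "case_sum (bn T) (\<lambda>\<phi>. {}) (S_action_act T \<pi> \<alpha>) =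
      names_act \<pi> (case_sum (bn T) (\<lambda>\<phi>. {}) \<alpha>)"
    if "\<pi> \<in> name_perms srt" "\<alpha> \<in> S_ACT T" for \<pi> \<alpha>
    using that bnT_eqv by (auto simp: names_act_def)
  have "nominal_set srt (STATES T) (state_act T)" "nominal_set srt (PRED T) (pred_act T)"
    using T by (simp_all add: nominal_transition_system_def)
  moreover have "STATES (S_transform srt T) = STATES T" "PRED (S_transform srt T) = PRED T"
    "ACT (S_transform srt T) = S_ACT T" "state_act (S_transform srt T) = state_act T"
    "pred_act (S_transform srt T) = pred_act T" "action_act (S_transform srt T) = S_action_act T"
    "sat (S_transform srt T) = {}" "bn (S_transform srt T) = case_sum (bn T) (\<lambda>\<phi>. {})"
    by (simp_all add: S_transform_def)
  ultimately show ?thesis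
    unfolding nominal_transition_system_def
    using nom sub bn fin eqv S_equivariant by (simp add: equivariant_rel_def)
qed

end

end

theory Submission
  imports Defs
begin

text \<open>Every bisimulation of \<open>T\<close> is, as the same relation, a bisimulation of
  \<open>S_transform srt T\<close>, so the union of the former lies in the union of the latter. By
  \<open>S_step_Inl\<close>, steps on original actions agree in both systems, so the simulation
  clause for \<open>T\<close> answers them. By \<open>S_step_Inr\<close>, a predicate step is a
  self-loop recording that the predicate holds, so the predicate clause for \<open>T\<close> answers
  it.\<close>

lemma bisimulation_S_transform:
  assumes n: "sorted_names srt" and T: "nominal_transition_system srt T"
    and R: "bisimulation srt T R"
  shows "bisimulation srt (S_transform srt T) R"
proof -
  let ?S = "S_transform srt T"
  have S_simps: "STATES ?S = STATES T" "ACT ?S = S_ACT T" "state_act ?S = state_act T"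
    "sat ?S = {}" "bn ?S = case_sum (bn T) (\<lambda>\<phi>. {})"
    by (simp_all add: S_transform_def)
  have states: "R \<subseteq> STATES T \<times> STATES T" and "sym R"
    using R by (simp_all add: bisimulation_def)
  have simulates: "\<exists>Q'\<in>STATES T. step srt ?S Q \<alpha> Q' \<and> (P', Q') \<in> R"
    if PQ: "(P, Q) \<in> R" and \<alpha>: "\<alpha> \<in> S_ACT T" and P': "P' \<in> STATES T"
      and fresh: "bn ?S \<alpha> \<inter> supp srt (state_act T) Q = {}" and step: "step srt ?S P \<alpha> P'"
    for P Q \<alpha> P'
    using \<alpha>
  proof (rule PlusE)
    fix a assume a: "a \<in> ACT T" "\<alpha> = Inl a"
    \<comment> \<open>Binding names and the action on states are unchanged on \<open>Inl a\<close>,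
      so the freshness condition is the one required in \<open>T\<close>.\<close>
    have "bn T a \<inter> supp srt (state_act T) Q = {}" "step srt T P a P'"
      using fresh step S_step_Inl[OF n T a(1) P'] by (simp_all add: a(2) S_simps)
    then obtain Q' where "Q' \<in> STATES T" "step srt T Q a Q'" "(P', Q') \<in> R"
      using R PQ a(1) P' unfolding bisimulation_def by blast
    then show ?thesis using S_step_Inl[OF n T a(1)] a(2) by blast
  next
    fix \<phi> assume \<phi>: "\<phi> \<in> PRED T" "\<alpha> = Inr \<phi>"
    have "P' = P" "(P, \<phi>) \<in> sat T"
      using step S_step_Inr[OF n T \<phi>(1) P'] by (simp_all add: \<phi>(2))
    moreover from this have "(Q, \<phi>) \<in> sat T"
      using R PQ \<phi>(1) unfolding bisimulation_def by blast
    \<comment> \<open>The witness is \<open>Q\<close> itself: both sides loop, so the derivatives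
      are again the pair \<open>(P, Q)\<close> in \<open>R\<close>.\<close>
    ultimately show ?thesis
      using PQ states S_step_Inr[OF n T \<phi>(1)] \<phi>(2) by blast
  qed
  show ?thesis
    \<comment> \<open>The predicate clause is vacuous since \<open>sat ?S\<close> is empty;
      \<open>bn ?S\<close> stays folded to match \<open>simulates\<close>.\<close>
    unfolding bisimulation_def S_simps(1-4)
    using states \<open>sym R\<close> simulates by blast
qed

theorem theorem8p2:
  fixes srt :: "'n \<Rightarrow> 's"
    and T :: "('n, 'st, 'pr, 'ac) nts"
    and P Q :: 'st
  assumes "sorted_names srt"
    and "nominal_transition_system srt T"
    and "P \<in> STATES T" and "Q \<in> STATES T"
    and "(P, Q) \<in> bisimilarity srt T"
  shows "(P, Q) \<in> bisimilarity srt (S_transform srt T)"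
  using assms(5) bisimulation_S_transform[OF assms(1,2)] unfolding bisimilarity_def by blast

end
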